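(* Consider a causal model on a causal structure $\mathcal G$, and let $X,Y,Z$ be pairwise disjoint sets of observed nodes with $X,Y$ non-empty. If the affects relation $X\vDash Y\mid\mathrm{do}(Z)$ holds and is Clus$_3$, then each $e_Z\in Z$ is a cause of at least one element $e_Y\in Y$, i.e. there is a directed path from $e_Z$ to $e_Y$ in $\mathcal G$.
   Context: **Causal model.** A causal structure is a directed graph $\mathcal G$ (cycles allowed) whose nodes are observed or unobserved; the finitely many observed nodes are random variables. For sets of nodes, $AB:=A\cup B$. A path between two nodes (ignoring edge directions) is blocked by a set $C$ if it contains a chain $A\to V\to B$ or fork $A\leftarrow V\to B$ with $V\in C$, or a collider $A\to V\leftarrow B$ with neither $V$ nor any descendant of $V$ in $C$. For disjoint $A,B,C$, $(A\perp^dB\mid C)_{\mathcal G}$ means every path from an element of $A$ to an element of $B$ is blocked by $C$. A distribution $P$ over the observed nodes has the d-separation property relative to $\mathcal G$ if $(A\perp^dB|C)_{\mathcal G}$ implies $P(AB|C)=P(A|C)P(B|C)$ for all disjoint sets $A,B,C$ of observed nodes. For a set $X$ of observed nodes, $\mathcal G_{\mathrm{do}(X)}$ is $\mathcal G$ with all edges into nodes of $X$ removed ($\mathcal G_{\mathrm{do}(\emptyset)}=\mathcal G$). A causal model consists of $\mathcal G$, and for every set $X$ of observed nodes a distribution $P_{\mathcal G_{\mathrm{do}(X)}}$ of the observed nodes with the d-separation property relative to $\mathcal G_{\mathrm{do}(X)}$, such that if $X$ consists of nodes exogenous in $\mathcal G$ and is disjoint from $Y$, then $P_{\mathcal G_{\mathrm{do}(Y)}}(R|XY)=P_{\mathcal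 G_{\mathrm{do}(XY)}}(R|XY)$ for $R$ the remaining observed nodes. Conditional distributions given values of intervened nodes are taken as specified for all such values. Standing fact of the framework (third rule of do-calculus): for disjoint sets of observed nodes, $P_{\mathcal G_{\mathrm{do}(XZ)}}(Y|XZ)=P_{\mathcal G_{\mathrm{do}(X)}}(Y|X)$ whenever $(Y\perp^dZ\mid X)_{\mathcal G_{\mathrm{do}(XZ)}}$. **Affects relations.** For pairwise disjoint $X,Y,Z$ with $X,Y$ non-empty, $X\vDash Y\mid\mathrm{do}(Z)$ holds iff there are values $x,z$ with $P_{\mathcal G_{\mathrm{do}(XZ)}}(Y|X=x,Z=z)\ne P_{\mathcal G_{\mathrm{do}(Z)}}(Y|Z=z)$. **Clustering.** $X\vDash Y\mid\mathrm{do}(Z)$ is Clus$_3$ (clustered in the third argument) if $|Z|\ge1$ and no $s_Z\subsetneq Z$ (possibly empty) satisfies $X\vDash Y\mid\mathrm{do}(s_Z)$. *)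

theory Defs
  imports "HOL-Probability.Probability"
begin

section \<open>Directed graphs and d-separation\<close>

definition do_edges :: "('n \<times> 'n) set \<Rightarrow> 'n set \<Rightarrow> ('n \<times> 'n) set" where
  "do_edges E X = {(u, v) \<in> E. v \<notin> X}"

definition exogenous :: "('n \<times> 'n) set \<Rightarrow> 'n \<Rightarrow> bool" where
  "exogenous E v \<longleftrightarrow> (\<forall>u. (u, v) \<notin> E)"

definition is_cause :: "('n \<times> 'n) set \<Rightarrow> 'n \<Rightarrow> 'n \<Rightarrow> bool" where
  "is_cause E u v \<longleftrightarrow> (u, v) \<in> E\<^sup>+"

text \<open>A path ignoring edge directions is given by its nodes \<open>ns\<close> together with the orientation of
  the edge used in each step: \<open>ds ! i\<close> holds iff the step from \<open>ns ! i\<close> to \<open>ns ! Suc i\<close> follows an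
  edge forwards. The orientations have to be recorded because in a cyclic graph both \<open>(u, v)\<close> and
  \<open>(v, u)\<close> may be edges.\<close>

definition upath :: "('n \<times> 'n) set \<Rightarrow> 'n list \<Rightarrow> bool list \<Rightarrow> bool" where
  "upath E ns ds \<longleftrightarrow> length ns = Suc (length ds) \<and> distinct ns \<and>
     (\<forall>i < length ds. if ds ! i then (ns ! i, ns ! Suc i) \<in> E else (ns ! Suc i, ns ! i) \<in> E)"

text \<open>The inner node \<open>ns ! Suc i\<close> is a collider iff it is entered by a forward step and left by a
  backward step; otherwise it is the middle node of a chain or of a fork.\<close>

definition path_blocked :: "('n \<times> 'n) set \<Rightarrow> 'n set \<Rightarrow> 'n list \<Rightarrow> bool list \<Rightarrow> bool" where
  "path_blocked E C ns ds \<longleftrightarrow>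
     (\<exists>i. Suc i < length ds \<and>
        (if ds ! i \<and> \<not> ds ! Suc i
         then ns ! Suc i \<notin> C \<and> (\<forall>c \<in> C. (ns ! Suc i, c) \<notin> E\<^sup>+)
         else ns ! Suc i \<in> C))"

definition d_sep :: "('n \<times> 'n) set \<Rightarrow> 'n set \<Rightarrow> 'n set \<Rightarrow> 'n set \<Rightarrow> bool" where
  "d_sep E A B C \<longleftrightarrow>
     (\<forall>ns ds. upath E ns ds \<and> hd ns \<in> A \<and> last ns \<in> B \<longrightarrow> path_blocked E C ns ds)"

section \<open>Distributions of families of random variables\<close>

text \<open>The variable at node \<open>v\<close> takes values in the measurable space \<open>M v\<close> (a \<open>count_space\<close> for a
  discrete variable). A joint value of the variables in \<open>A\<close> is a point of \<open>PiM A M\<close>, and a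
  distribution of these variables is a probability measure on \<open>PiM A M\<close>.\<close>

definition marginal :: "('n \<Rightarrow> 'a measure) \<Rightarrow> 'n set \<Rightarrow> ('n \<Rightarrow> 'a) measure \<Rightarrow> ('n \<Rightarrow> 'a) measure" where
  "marginal M A N = distr N (PiM A M) (\<lambda>\<omega>. restrict \<omega> A)"

text \<open>\<open>\<kappa>\<close> is a version of the regular conditional distribution \<open>N(R | C)\<close>. If all spaces are discrete,
  this says that \<open>\<kappa> c\<close> has the point masses \<open>N(R = r, C = c) / N(C = c)\<close> whenever \<open>N(C = c) > 0\<close>.\<close>

definition is_cond_dist ::
  "('n \<Rightarrow> 'a measure) \<Rightarrow> ('n \<Rightarrow> 'a) measure \<Rightarrow> 'n set \<Rightarrow> 'n set
     \<Rightarrow> (('n \<Rightarrow> 'a) \<Rightarrow> ('n \<Rightarrow> 'a) measure) \<Rightarrow> bool" where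
  "is_cond_dist M N R C \<kappa> \<longleftrightarrow>
     \<kappa> \<in> measurable (PiM C M) (prob_algebra (PiM R M)) \<and>
     (\<forall>S \<in> sets (PiM C M). \<forall>T \<in> sets (PiM R M).
        emeasure N {\<omega> \<in> space N. restrict \<omega> C \<in> S \<and> restrict \<omega> R \<in> T} =
        (\<integral>\<^sup>+ \<omega>. indicator S (restrict \<omega> C) * emeasure (\<kappa> (restrict \<omega> C)) T \<partial>N))"

text \<open>The conditional independence \<open>N(A B | C) = N(A | C) N(B | C)\<close>, with conditional probabilities
  taken with respect to the \<open>\<sigma>\<close>-algebra generated by the variables in \<open>C\<close>.\<close>

definition cond_prob_given ::
  "('n \<Rightarrow> 'a measure) \<Rightarrow> ('n \<Rightarrow> 'a) measure \<Rightarrow> 'n set \<Rightarrow> ('n \<Rightarrow> 'a) set \<Rightarrow> ('n \<Rightarrow> 'a) \<Rightarrow> real" where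
  "cond_prob_given M N C S =
     real_cond_exp N (vimage_algebra (space N) (\<lambda>\<omega>. restrict \<omega> C) (PiM C M)) (indicator S)"

definition cond_indep ::
  "('n \<Rightarrow> 'a measure) \<Rightarrow> ('n \<Rightarrow> 'a) measure \<Rightarrow> 'n set \<Rightarrow> 'n set \<Rightarrow> 'n set \<Rightarrow> bool" where
  "cond_indep M N A B C \<longleftrightarrow>
     (\<forall>S \<in> sets (PiM A M). \<forall>T \<in> sets (PiM B M).
        AE \<omega> in N.
          cond_prob_given M N C {\<omega> \<in> space N. restrict \<omega> A \<in> S \<and> restrict \<omega> B \<in> T} \<omega> =
          cond_prob_given M N C {\<omega> \<in> space N. restrict \<omega> A \<in> S} \<omega> *
          cond_prob_given M N C {\<omega> \<in> space N. restrict \<omega> B \<in> T} \<omega>)"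

definition d_sep_property ::
  "('n \<times> 'n) set \<Rightarrow> 'n set \<Rightarrow> ('n \<Rightarrow> 'a measure) \<Rightarrow> ('n \<Rightarrow> 'a) measure \<Rightarrow> bool" where
  "d_sep_property E Obs M N \<longleftrightarrow>
     (\<forall>A B C. A \<subseteq> Obs \<and> B \<subseteq> Obs \<and> C \<subseteq> Obs \<and> A \<inter> B = {} \<and> A \<inter> C = {} \<and> B \<inter> C = {} \<and>
        d_sep E A B C \<longrightarrow> cond_indep M N A B C)"

section \<open>Causal models\<close>

text \<open>\<open>V\<close> are the nodes, \<open>Obs\<close> the observed ones, \<open>E\<close> the edges. \<open>P X\<close> is the joint distribution of
  all observed nodes under the intervention \<open>do(X)\<close>. Conditioning \<open>P X\<close> on values of \<open>X\<close> only makes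
  sense up to null sets, whereas the conditional distributions given the intervened nodes are
  specified for all values; they are therefore part of the model: \<open>K X x\<close> is the distribution of the
  remaining observed nodes under \<open>do(X)\<close> given \<open>X = x\<close>.

  In \<open>exogenous_do\<close>, the right-hand side \<open>K (X \<union> Y)\<close> of
  \<open>P\<^bsub>do(Y)\<^esub>(R | X Y) = P\<^bsub>do(X Y)\<^esub>(R | X Y)\<close> is required to be, for every value \<open>y\<close> of the
  intervened nodes, a version of the conditional distribution on the left-hand side, which is
  determined only almost surely in the values of the non-intervened nodes \<open>X\<close>.\<close>

locale causal_model =
  fixes V :: "'n set" and Obs :: "'n set" and E :: "('n \<times> 'n) set"
    and M :: "'n \<Rightarrow> 'a measure"
    and P :: "'n set \<Rightarrow> ('n \<Rightarrow> 'a) measure"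
    and K :: "'n set \<Rightarrow> ('n \<Rightarrow> 'a) \<Rightarrow> ('n \<Rightarrow> 'a) measure"
  assumes edges: "E \<subseteq> V \<times> V"
    and observed: "Obs \<subseteq> V" "finite Obs"
    and dist: "\<And>X. X \<subseteq> Obs \<Longrightarrow> prob_space (P X) \<and> sets (P X) = sets (PiM Obs M)"
    and d_sep_prop: "\<And>X. X \<subseteq> Obs \<Longrightarrow> d_sep_property (do_edges E X) Obs M (P X)"
    and cond_dist: "\<And>X. X \<subseteq> Obs \<Longrightarrow> is_cond_dist M (P X) (Obs - X) X (K X)"
    and exogenous_do: "\<And>X Y y. X \<subseteq> Obs \<Longrightarrow> Y \<subseteq> Obs \<Longrightarrow> X \<inter> Y = {} \<Longrightarrow> \<forall>v \<in> X. exogenous E v \<Longrightarrow>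
      y \<in> space (PiM Y M) \<Longrightarrow>
      is_cond_dist M (K Y y) (Obs - (X \<union> Y)) X (\<lambda>x. K (X \<union> Y) (merge X Y (x, y)))"

text \<open>The third rule of do-calculus. It is a standing assumption of the framework and does not follow
  from the axioms of \<open>causal_model\<close>, which relate different interventions on exogenous nodes only.\<close>

definition do_calculus_rule3 ::
  "'n set \<Rightarrow> ('n \<times> 'n) set \<Rightarrow> ('n \<Rightarrow> 'a measure)
     \<Rightarrow> ('n set \<Rightarrow> ('n \<Rightarrow> 'a) \<Rightarrow> ('n \<Rightarrow> 'a) measure) \<Rightarrow> bool" where
  "do_calculus_rule3 Obs E M K \<longleftrightarrow>
     (\<forall>X Y Z. X \<subseteq> Obs \<and> Y \<subseteq> Obs \<and> Z \<subseteq> Obs \<and> X \<inter> Y = {} \<and> X \<inter> Z = {} \<and> Y \<inter> Z = {} \<and>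
        d_sep (do_edges E (X \<union> Z)) Y Z X \<longrightarrow>
        (\<forall>x \<in> space (PiM X M). \<forall>z \<in> space (PiM Z M).
           marginal M Y (K (X \<union> Z) (merge X Z (x, z))) = marginal M Y (K X x)))"

text \<open>The relation \<open>X \<Turnstile> Y | do(Z)\<close>.\<close>

definition affects ::
  "('n \<Rightarrow> 'a measure) \<Rightarrow> ('n set \<Rightarrow> ('n \<Rightarrow> 'a) \<Rightarrow> ('n \<Rightarrow> 'a) measure)
     \<Rightarrow> 'n set \<Rightarrow> 'n set \<Rightarrow> 'n set \<Rightarrow> bool" where
  "affects M K X Y Z \<longleftrightarrow>
     (\<exists>x \<in> space (PiM X M). \<exists>z \<in> space (PiM Z M).
        marginal M Y (K (X \<union> Z) (merge X Z (x, z))) \<noteq> marginal M Y (K Z z))"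

definition clus3 ::
  "('n \<Rightarrow> 'a measure) \<Rightarrow> ('n set \<Rightarrow> ('n \<Rightarrow> 'a) \<Rightarrow> ('n \<Rightarrow> 'a) measure)
     \<Rightarrow> 'n set \<Rightarrow> 'n set \<Rightarrow> 'n set \<Rightarrow> bool" where
  "clus3 M K X Y Z \<longleftrightarrow> card Z \<ge> 1 \<and> \<not> (\<exists>s. s \<subset> Z \<and> affects M K X Y s)"

end

theory Submission imports Defs begin

text \<open>If \<open>e \<in> Z\<close> causes no element of \<open>Y\<close>, then after cutting all edges into \<open>W \<union> {e}\<close> every path
  between \<open>Y\<close> and \<open>e\<close> leaves \<open>e\<close> forwards and must contain a collider; the collider has an incoming
  edge, so neither it nor its descendants meet \<open>W\<close>, and the path is blocked by \<open>W\<close>. Rule 3 with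
  \<open>W = X \<union> (Z - {e})\<close> and with \<open>W = Z - {e}\<close> then removes \<open>e\<close> from both sides of the affects relation,
  so that it also holds with \<open>do(Z - {e})\<close>, contradicting \<open>Clus\<^sub>3\<close>.\<close>

lemma trancl_do_edges_subset: "(do_edges E X)\<^sup>+ \<subseteq> E\<^sup>+"
  by (rule subsetI, rule trancl_mono) (auto simp: do_edges_def)

lemma trancl_do_edges_target_notin: "(u, v) \<in> (do_edges E X)\<^sup>+ \<Longrightarrow> v \<notin> X"
  by (induction rule: trancl.induct) (auto simp: do_edges_def)

text \<open>A backward step is an edge pointing towards the head of the list, so a tail of backward
  steps, read from its end, is a directed walk out of \<open>last ns\<close>. The closure is
  reflexive because the tail may be empty.\<close>

lemma upath_backward_rtrancl:
  assumes "upath E ns ds" "j \<le> length ds" "\<forall>i. j \<le> i \<and> i < length ds \<longrightarrow> \<not> ds ! i"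
  shows "(last ns, ns ! j) \<in> E\<^sup>*"
  using assms(2,3)
proof (induction j rule: inc_induct)
  case base
  have "last ns = ns ! length ds"
    using assms(1) by (subst last_conv_nth) (auto simp: upath_def)
  then show ?case by simp
next
  case (step n)
  then have "(ns ! Suc n, ns ! n) \<in> E" using assms(1) by (auto simp: upath_def)
  moreover have "(last ns, ns ! Suc n) \<in> E\<^sup>*" using step by simp
  ultimately show ?case by (rule rtrancl_into_rtrancl[rotated])
qed

lemma d_sep_do_not_cause:
  assumes nc: "\<And>y. y \<in> Y \<Longrightarrow> \<not> is_cause E e y" and "e \<notin> Y"
  shows "d_sep (do_edges E (W \<union> {e})) Y {e} W"
  unfolding d_sep_def
proof (intro allI impI, elim conjE)
  fix ns ds
  let ?F = "do_edges E (W \<union> {e})"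
  assume up: "upath ?F ns ds" and hd: "hd ns \<in> Y" and "last ns \<in> {e}"
  then have last: "last ns = e" by simp
  have len: "length ns = Suc (length ds)" using up by (simp add: upath_def)
  have hd0: "hd ns = ns ! 0" using len by (cases ns) auto
  \<comment> \<open>The list runs from \<open>Y\<close> to \<open>e\<close>, so \<open>j\<close> is
    where the longest all-backward tail begins; the empty tail at \<open>length ds\<close> always
    qualifies.\<close>
  define Q where "Q j \<longleftrightarrow> j \<le> length ds \<and> (\<forall>i. j \<le> i \<and> i < length ds \<longrightarrow> \<not> ds ! i)" for j
  define j where "j = (LEAST j. Q j)"
  have "Q (length ds)" by (auto simp: Q_def)
  then have Qj: "Q j" and least: "\<And>k. Q k \<Longrightarrow> j \<le> k"
    unfolding j_def by (auto intro: LeastI Least_le)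
  have bwd: "(e, ns ! j) \<in> ?F\<^sup>*"
    using upath_backward_rtrancl[OF up] Qj last by (auto simp: Q_def)
  show "path_blocked ?F W ns ds"
  proof (cases j)
    \<comment> \<open>The whole path is directed from \<open>e\<close> to its head in
      \<open>Y\<close>. The trivial path \<open>[e]\<close> also falls here and is excluded by
      \<open>e \<notin> Y\<close>.\<close>
    case 0
    then have "(e, hd ns) \<in> ?F\<^sup>*" using bwd hd0 by simp
    moreover have "e \<noteq> hd ns" using hd \<open>e \<notin> Y\<close> by auto
    ultimately have "(e, hd ns) \<in> E\<^sup>+"
      using trancl_do_edges_subset[of E "W \<union> {e}"] by (auto dest!: rtranclD)
    then show ?thesis using nc[OF hd] by (simp add: is_cause_def)
  next
    case (Suc i)
    \<comment> \<open>Since \<open>Q (Suc i)\<close> holds, \<open>Q i\<close> can fail only at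
      index \<open>i\<close> itself: the step just before the tail is forward.\<close>
    have "\<not> Q i" using least[of i] Suc by auto
    moreover have i: "i < length ds" using Qj Suc by (simp add: Q_def)
    ultimately have fwd: "ds ! i"
      using Qj Suc unfolding Q_def by (metis le_neq_implies_less less_imp_le Suc_leI)
    have edge: "(ns ! i, ns ! j) \<in> ?F" using up fwd i Suc by (auto simp: upath_def)
    then have notin: "ns ! j \<notin> W" "ns ! j \<noteq> e" by (auto simp: do_edges_def)
    \<comment> \<open>With an empty tail the path would end with an edge into \<open>e\<close>, but
      these are cut. Hence a backward step follows and \<open>ns ! j\<close> is a collider.\<close>
    have "j \<noteq> length ds"
    proof
      assume "j = length ds"
      then have "ns ! j = last ns" using len by (subst last_conv_nth) auto
      then show False using last notin by simp
    qed
    then have "Suc i < length ds" "\<not> ds ! Suc i" using Qj Suc by (auto simp: Q_def)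
    moreover have "\<forall>c \<in> W. (ns ! j, c) \<notin> ?F\<^sup>+"
      by (auto dest: trancl_do_edges_target_notin)
    ultimately show ?thesis
      unfolding path_blocked_def using fwd notin Suc by auto
  qed
qed

text \<open>Rule 3 with the single node \<open>e\<close> removed. One joint value \<open>w\<close>
  in place of a merged pair lets it apply both to \<open>merge X Z (x, z)\<close> and to
  \<open>z\<close>.\<close>

lemma do_calculus_rule3_drop_non_cause:
  assumes rule3: "do_calculus_rule3 Obs E M K"
    and "W \<subseteq> Obs" "Y \<subseteq> Obs" "e \<in> Obs" "W \<inter> Y = {}" "e \<notin> W" "e \<notin> Y"
    and nc: "\<And>y. y \<in> Y \<Longrightarrow> \<not> is_cause E e y"
    and w: "w \<in> space (PiM (insert e W) M)"
  shows "marginal M Y (K (insert e W) w) = marginal M Y (K W (restrict w W))"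
proof -
  have "restrict w W \<in> space (PiM W M)" "restrict w {e} \<in> space (PiM {e} M)"
    using w by (auto simp: space_PiM)
  moreover have "d_sep (do_edges E (W \<union> {e})) Y {e} W"
    by (rule d_sep_do_not_cause) (use nc assms(7) in auto)
  ultimately have "marginal M Y (K (W \<union> {e}) (merge W {e} (restrict w W, restrict w {e})))
      = marginal M Y (K W (restrict w W))"
    by (intro rule3[unfolded do_calculus_rule3_def, rule_format]) (use assms(2-7) in auto)
  \<comment> \<open>A point of the product space is \<open>undefined\<close> off its index set, so
    its two restrictions determine it.\<close>
  moreover have "merge W {e} (restrict w W, restrict w {e}) = w"
    using w by (auto simp: merge_def space_PiM PiE_def extensional_def)
  ultimately show ?thesis by simp
qed

theorem corollary4p17:
  fixes V Obs :: "'n set" and E :: "('n \<times> 'n) set"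
    and M :: "'n \<Rightarrow> 'a measure"
    and P :: "'n set \<Rightarrow> ('n \<Rightarrow> 'a) measure"
    and K :: "'n set \<Rightarrow> ('n \<Rightarrow> 'a) \<Rightarrow> ('n \<Rightarrow> 'a) measure"
    and X Y Z :: "'n set"
  assumes "causal_model V Obs E M P K"
    and "do_calculus_rule3 Obs E M K"
    and "X \<subseteq> Obs" and "Y \<subseteq> Obs" and "Z \<subseteq> Obs"
    and "X \<inter> Y = {}" and "X \<inter> Z = {}" and "Y \<inter> Z = {}"
    and "X \<noteq> {}" and "Y \<noteq> {}"
    and "affects M K X Y Z"
    and "clus3 M K X Y Z"
  shows "\<forall>e\<^sub>Z \<in> Z. \<exists>e\<^sub>Y \<in> Y. is_cause E e\<^sub>Z e\<^sub>Y"
proof (rule ballI, rule ccontr)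
  fix e assume e: "e \<in> Z" and "\<not> (\<exists>e\<^sub>Y \<in> Y. is_cause E e e\<^sub>Y)"
  then have nc: "\<And>y. y \<in> Y \<Longrightarrow> \<not> is_cause E e y" by blast
  define s where "s = Z - {e}"
  have Z: "Z = insert e s" and "s \<subset> Z" using e by (auto simp: s_def)
  then have not_affects: "\<not> affects M K X Y s" using assms(12) unfolding clus3_def by blast
  obtain x z where x: "x \<in> space (PiM X M)" and z: "z \<in> space (PiM Z M)"
    and ne: "marginal M Y (K (X \<union> Z) (merge X Z (x, z))) \<noteq> marginal M Y (K Z z)"
    using assms(11) unfolding affects_def by blast
  have zs: "restrict z s \<in> space (PiM s M)" using z Z by (auto simp: space_PiM)
  have XZ: "insert e (X \<union> s) = X \<union> Z" using Z by auto
  have "merge X Z (x, z) \<in> space (PiM (insert e (X \<union> s)) M)"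
    using x z unfolding XZ by (auto simp: space_PiM merge_def PiE_def Pi_def extensional_def)
  then have drop_left: "marginal M Y (K (X \<union> Z) (merge X Z (x, z)))
      = marginal M Y (K (X \<union> s) (restrict (merge X Z (x, z)) (X \<union> s)))"
    unfolding XZ[symmetric]
    by (intro do_calculus_rule3_drop_non_cause[OF assms(2)])
      (use assms(3-8) e nc in \<open>auto simp: s_def\<close>)
  have restr: "restrict (merge X Z (x, z)) (X \<union> s) = merge X s (x, restrict z s)"
    using Z by (auto simp: merge_def restrict_def fun_eq_iff)
  \<comment> \<open>The absence of an affects relation at \<open>s\<close> is used only at the
    values inherited from \<open>x\<close> and \<open>z\<close>. This equality joins the two
    reductions and contradicts \<open>ne\<close>.\<close>
  have eq: "marginal M Y (K (X \<union> s) (merge X s (x, restrict z s)))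
      = marginal M Y (K s (restrict z s))"
    using not_affects x zs unfolding affects_def by blast
  have "z \<in> space (PiM (insert e s) M)" using z unfolding Z .
  then have drop_right: "marginal M Y (K (insert e s) z) = marginal M Y (K s (restrict z s))"
    by (intro do_calculus_rule3_drop_non_cause[OF assms(2)])
      (use assms(4,5,8) e nc in \<open>auto simp: s_def\<close>)
  show False
    using ne drop_left[unfolded restr eq] drop_right[folded Z] by simp
qed

end
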